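(* Let $d\geq 1$ and $s\geq 2$ be integers. Let $X$ be an $s$-distance set in $\mathbb{R}^d$ with $D(X)=\{\alpha_1,\ldots,\alpha_s\}$, and let \[ N=\binom{d+s-1}{s-1}+\binom{d+s-2}{s-2}. \] If $|X| \geq N+(N+1)/t$ for some positive integer $t$, then \[ K_j=\prod_{i=1,\, i\ne j}^s \frac{\alpha_i}{\alpha_i-\alpha_j} \] is an algebraic integer of degree at most $t$ for each $j \in \{1,\ldots,s\}$.
   Context: For $X \subset \mathbb{R}^d$, $D(X)=\{\|x-y\|^2 : x,y\in X,\ x\neq y\}$ is the set of squared Euclidean distances between two distinct points of $X$. A finite set $X\subset\mathbb{R}^d$ is an $s$-distance set if the number of distances between two distinct points of $X$ equals $s$, i.e. $|D(X)|=s$; then $\alpha_1,\ldots,\alpha_s$ denote the $s$ distinct elements of $D(X)$. An algebraic integer is a complex number that is a root of a monic polynomial with integer coefficients; its degree is its degree over $\mathbb{Q}$. The number $N$ is the dimension of the space $P_{s-1}(\mathbb{R}^d)$ of real polynomial functions on $\mathbb{R}^d$ spanned by $\xi_0^{\lambda_0}\xi_1^{\lambda_1}\cdots\xi_d^{\lambda_d}$ with $\lambda_0+\cdots+\lambda_d\leq s-1$, where $\xi_0=\xi_1^2+\cdots+\xi_d^2$. *)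

theory Defs
  imports "HOL-Analysis.Analysis" "HOL-Computational_Algebra.Computational_Algebra"
begin

definition sq_dists :: "(real ^ 'd) set \<Rightarrow> real set" where
  "sq_dists X = {(norm (x - y))\<^sup>2 | x y. x \<in> X \<and> y \<in> X \<and> x \<noteq> y}"

definition distance_set :: "nat \<Rightarrow> (real ^ 'd) set \<Rightarrow> bool" where
  "distance_set s X \<longleftrightarrow> finite X \<and> card (sq_dists X) = s"

definition min_poly_rat :: "complex \<Rightarrow> rat poly" where
  "min_poly_rat x =
     (THE p. irreducible p \<and> lead_coeff p = 1 \<and> poly (map_poly of_rat p) x = 0)"

(* Meaningful for algebraic x only: there the minimal polynomial exists and is unique,
   see min_poly_rat_ex1. *)
definition algebraic_degree :: "complex \<Rightarrow> nat" where
  "algebraic_degree x = degree (min_poly_rat x)"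

lemma poly_of_rat_pCons:
  fixes x :: complex
  shows "poly (map_poly of_rat (pCons a p)) x = of_rat a + x * poly (map_poly of_rat p) x"
  by (simp add: map_poly_pCons)

lemma poly_of_rat_add:
  fixes x :: complex
  shows "poly (map_poly of_rat (p + q)) x =
    poly (map_poly of_rat p) x + poly (map_poly of_rat q) x"
proof (induction p arbitrary: q)
  case 0
  then show ?case by simp
next
  case (pCons a p)
  show ?case
    by (cases q) (simp add: poly_of_rat_pCons pCons.IH of_rat_add distrib_left)
qed

lemma poly_of_rat_smult:
  fixes x :: complex
  shows "poly (map_poly of_rat (smult c p)) x = of_rat c * poly (map_poly of_rat p) x"
  by (induction p) (simp_all add: poly_of_rat_pCons of_rat_mult algebra_simps)

lemma poly_of_rat_mult:
  fixes x :: complex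
  shows "poly (map_poly of_rat (p * q)) x =
    poly (map_poly of_rat p) x * poly (map_poly of_rat q) x"
  by (induction p)
     (simp_all add: poly_of_rat_pCons poly_of_rat_add poly_of_rat_smult algebra_simps)

lemma min_poly_rat_ex1:
  assumes "algebraic (x :: complex)"
  shows "\<exists>!p :: rat poly. irreducible p \<and> lead_coeff p = 1 \<and> poly (map_poly of_rat p) x = 0"
proof -
  let ?ev = "\<lambda>p :: rat poly. poly (map_poly of_rat p) x"
  obtain r :: "complex poly" where "\<And>i. coeff r i \<in> \<rat>" "poly r x = 0" "r \<noteq> 0"
    using assms unfolding algebraic_altdef by blast
  moreover from this(1) obtain r' where "r = map_poly of_rat r'"
    using ratpolyE by blast
  ultimately have "\<exists>p. p \<noteq> 0 \<and> ?ev p = 0" by (intro exI[of _ r']) auto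
  then obtain m where m: "m \<noteq> 0" "?ev m = 0"
    and least: "\<And>p. p \<noteq> 0 \<Longrightarrow> ?ev p = 0 \<Longrightarrow> degree m \<le> degree p"
    using ex_has_least_nat[of "\<lambda>p. p \<noteq> 0 \<and> ?ev p = 0" _ degree] by metis
  define q where "q = smult (inverse (lead_coeff m)) m"
  have q: "q \<noteq> 0" "?ev q = 0" "lead_coeff q = 1" "degree q = degree m"
    using m by (simp_all add: q_def poly_of_rat_smult)
  have no_unit: "?ev p \<noteq> 0" if p: "p \<noteq> 0" "degree p = 0" for p
  proof -
    obtain c where "p = [:c:]" using p(2) by (rule degree_eq_zeroE)
    then show ?thesis using p(1) by (simp add: poly_of_rat_pCons)
  qed
  have "irreducible q"
  proof (rule irreducibleI)
    show "q \<noteq> 0" by fact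
    show "\<not> is_unit q" using q no_unit[of q] by (auto simp: is_unit_iff_degree)
    fix a b assume ab: "q = a * b"
    then have nz: "a \<noteq> 0" "b \<noteq> 0" using q(1) by auto
    then have deg: "degree a + degree b = degree m"
      using ab q(4) by (simp add: degree_mult_eq)
    have "?ev a = 0 \<or> ?ev b = 0" using ab q(2) by (simp add: poly_of_rat_mult)
    then have "degree m \<le> degree a \<or> degree m \<le> degree b" using least nz by blast
    then show "is_unit a \<or> is_unit b" using nz deg by (auto simp: is_unit_iff_degree)
  qed
  moreover have "p = q" if p: "irreducible p" "lead_coeff p = 1" "?ev p = 0" for p
  proof -
    have "?ev (p mod q) = 0"
      using poly_of_rat_add[of "p div q * q" "p mod q" x] p(3) q(2)
      by (simp add: poly_of_rat_mult)
    then have "p mod q = 0"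
      using least[of "p mod q"] degree_mod_less[of q p] q by fastforce
    then have "p = q * (p div q)"
      using div_mult_mod_eq[of p q] by (simp add: mult.commute)
    moreover have "\<not> is_unit q"
      using \<open>irreducible q\<close> by (rule irreducible_not_unit)
    ultimately have "is_unit (p div q)"
      using irreducibleD[OF p(1)] by blast
    then obtain c where "p div q = [:c:]" by (auto elim: is_unit_polyE)
    with \<open>p = q * (p div q)\<close> have pc: "p = smult c q" by simp
    have "c = 1"
      using p(2) unfolding pc lead_coeff_smult q(3) by simp
    then show "p = q" using pc by simp
  qed
  ultimately show ?thesis using q(2,3) by blast
qed

end

theory Submission
  imports Defs "Jordan_Normal_Form.Char_Poly" "HOL-Computational_Algebra.Field_as_Ring"
begin

text \<open>For fixed \<open>j\<close> consider the functions
  \<open>f\<^sub>x(y) = (\<Prod>i\<noteq>j. (\<alpha>\<^sub>i - |x - y|\<^sup>2) / (\<alpha>\<^sub>i - \<alpha>\<^sub>j))\<close> for \<open>x \<in> X\<close>. They lie in a space spanned by \<open>N\<close>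
  functions, while the matrix \<open>(f\<^sub>x(y))\<close> has diagonal entries \<open>K\<^sub>j\<close> and off-diagonal entries 0 or 1.
  So \<open>K\<^sub>j\<close> is a root of multiplicity at least \<open>|X| - N\<close> of the characteristic polynomial of an integer
  matrix of size \<open>|X|\<close>. All conjugates of \<open>K\<^sub>j\<close> have that multiplicity as well, so the degree of
  \<open>K\<^sub>j\<close> times \<open>|X| - N\<close> is at most \<open>|X|\<close>.\<close>

section \<open>A determinant divisibility for matrices of low rank\<close>

text \<open>This expresses that \<open>B * C\<close> has rank at most \<open>m\<close>. Over an
  integral domain, \<open>u\<close> may be a linear polynomial, and then the power of
  \<open>u\<close> records a root multiplicity.\<close>

lemma smult_one_mat_minus_mult_det_dvd:
  fixes u :: "'a :: idom"
  assumes B: "B \<in> carrier_mat n m" and C: "C \<in> carrier_mat m n" and "m \<le> n" and u: "u \<noteq> 0"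
  shows "u ^ (n - m) dvd Determinant.det (u \<cdot>\<^sub>m 1\<^sub>m n - B * C)"
proof -
  \<comment> \<open>Compute the determinant of the block matrix with rows \<open>(1, C)\<close> and \<open>(B, u)\<close> in two ways:
    by elimination (\<open>L\<close>), and after pulling \<open>u\<close> out of its last \<open>n\<close> columns once the first
    \<open>m\<close> rows are scaled by \<open>u\<close>.\<close>
  let ?S = "u \<cdot>\<^sub>m 1\<^sub>m n - B * C"
  define M where "M = four_block_mat (1\<^sub>m m) C B (u \<cdot>\<^sub>m 1\<^sub>m n)"
  define L where "L = four_block_mat (1\<^sub>m m) (0\<^sub>m m n) (- B) (1\<^sub>m n)"
  define D where "D = four_block_mat (u \<cdot>\<^sub>m 1\<^sub>m m) (0\<^sub>m m n) (0\<^sub>m n m) (1\<^sub>m n)"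
  define D' where "D' = four_block_mat (1\<^sub>m m) (0\<^sub>m m n) (0\<^sub>m n m) (u \<cdot>\<^sub>m 1\<^sub>m n)"
  define M' where "M' = four_block_mat (u \<cdot>\<^sub>m 1\<^sub>m m) C B (1\<^sub>m n)"
  have carr: "M \<in> carrier_mat (m + n) (m + n)" "L \<in> carrier_mat (m + n) (m + n)"
    "D \<in> carrier_mat (m + n) (m + n)" "D' \<in> carrier_mat (m + n) (m + n)"
    "M' \<in> carrier_mat (m + n) (m + n)"
    using B C by (auto simp: M_def L_def D_def D'_def M'_def)
  have BC: "B * C \<in> carrier_mat n n"
    using B C by simp
  have "L * M = four_block_mat (1\<^sub>m m) C (0\<^sub>m n m) ?S"
    unfolding L_def M_def
    apply (subst mult_four_block_mat[of _ m m _ n _ n _ _ m _ n])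
    using B C BC by (auto intro!: cong_four_block_mat)
  then have "Determinant.det L * Determinant.det M = Determinant.det ?S"
    using carr B C BC by (metis det_mult det_four_block_mat_lower_left_zero[of "1\<^sub>m m" m C n "0\<^sub>m n m" ?S]
        one_carrier_mat det_one mult_1 minus_carrier_mat)
  moreover have "Determinant.det L = 1"
    unfolding L_def using B by (subst det_four_block_mat_upper_right_zero[of _ m _ n]) auto
  moreover have "D * M = M' * D'"
    unfolding D_def M_def M'_def D'_def
    apply (subst mult_four_block_mat[of _ m m _ n _ n _ _ m _ n])
    using B C apply auto[8]
    apply (subst mult_four_block_mat[of _ m m _ n _ n _ _ m _ n])
    using B C apply auto[8]
    using B C by (auto intro!: cong_four_block_mat)
  then have "Determinant.det D * Determinant.det M = Determinant.det M' * Determinant.det D'"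
    using carr by (metis det_mult)
  moreover have "Determinant.det D = u ^ m"
    unfolding D_def by (subst det_four_block_mat_upper_right_zero[of _ m _ n]) auto
  moreover have "Determinant.det D' = u ^ n"
    unfolding D'_def by (subst det_four_block_mat_upper_right_zero[of _ m _ n]) auto
  ultimately have "u ^ m * Determinant.det ?S = Determinant.det M' * u ^ n"
    by simp
  also have "u ^ n = u ^ m * u ^ (n - m)"
    using \<open>m \<le> n\<close> by (simp flip: power_add)
  finally have "u ^ m * Determinant.det ?S = u ^ m * (Determinant.det M' * u ^ (n - m))"
    by (simp add: ac_simps)
  then show ?thesis
    using u by simp
qed

section \<open>Degrees of algebraic integers and root multiplicities\<close>

lemma order_power_eq:
  fixes p :: "'a :: idom poly"
  assumes "p \<noteq> 0"
  shows "order a (p ^ n) = n * order a p"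
  using assms by (induction n) (simp_all add: order_mult)

text \<open>The minimal polynomial of \<open>\<theta>\<close> is separable, so the multiplicity of
  \<open>\<theta>\<close> in \<open>p\<close> is the exponent of that polynomial as a factor of
  \<open>p\<close>; comparing degrees gives the bound.\<close>

lemma algebraic_degree_mult_order_le:
  fixes p :: "int poly" and \<theta> :: complex
  assumes monic: "lead_coeff p = 1" and r: "[:-\<theta>, 1:] ^ r dvd map_poly of_int p" and "r > 0"
  shows "algebraic_int \<theta>" and "algebraic_degree \<theta> * r \<le> degree p"
proof -
  interpret of_rat_poly: map_poly_inj_idom_hom "of_rat :: rat \<Rightarrow> complex" ..
  have "p \<noteq> 0"
    using monic by auto
  have "poly (map_poly of_int p) \<theta> = 0"
    using dvd_trans[OF dvd_power[of r] r] \<open>r > 0\<close> by (simp add: poly_eq_0_iff_dvd)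
  then show alg: "algebraic_int \<theta>"
    using monic by (auto simp: algebraic_int_altdef_ipoly)
  define m where "m = min_poly_rat \<theta>"
  let ?e = "\<lambda>q :: rat poly. map_poly of_rat q :: complex poly"
  have m: "irreducible m" "lead_coeff m = 1" "poly (?e m) \<theta> = 0"
    using theI'[OF min_poly_rat_ex1[OF algebraic_int_imp_algebraic[OF alg]]]
    unfolding m_def min_poly_rat_def by auto
  have "m \<noteq> 0" "degree m > 0"
    using m irreducible_not_unit[OF m(1)] is_unit_iff_degree[of m] by auto
  \<comment> \<open>If \<open>m\<close> did not divide \<open>q\<close>, a Bezout identity for the
    two, evaluated at \<open>\<theta>\<close>, would give 0 = 1.\<close>
  have dvd: "m dvd q" if "poly (?e q) \<theta> = 0" for q
  proof (rule ccontr)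
    assume "\<not> m dvd q"
    then have "coprime m q"
      using m(1) by (simp add: prime_elem_imp_coprime field_poly_irreducible_imp_prime)
    then obtain a b where "a * m + b * q = 1"
      by (metis bezout_coefficients_fst_snd coprime_iff_gcd_eq_1)
    then have "poly (?e (a * m + b * q)) \<theta> = 1"
      by simp
    then show False
      using m that by (simp add: poly_of_rat_add poly_of_rat_mult)
  qed
  define p' :: "rat poly" where "p' = map_poly of_int p"
  have p': "p' \<noteq> 0" "degree p' = degree p" "?e p' = map_poly of_int p"
    using \<open>p \<noteq> 0\<close> by (auto simp: p'_def map_poly_map_poly o_def)
  define k where "k = multiplicity m p'"
  obtain q where q: "p' = m ^ k * q" "\<not> m dvd q"
    unfolding k_def by (rule multiplicity_decompose'[OF p'(1)  irreducible_not_unit[OF m(1)]])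
  then have "q \<noteq> 0"
    using p'(1) by auto
  \<comment> \<open>In characteristic 0 the derivative of \<open>m\<close> is nonzero and of smaller
    degree, so \<open>\<theta>\<close> is not a root of it and is a simple root of
    \<open>m\<close>.\<close>
  have "pderiv m \<noteq> 0"
    using \<open>degree m > 0\<close> by (simp add: pderiv_eq_0_iff)
  then have "\<not> m dvd pderiv m"
    using \<open>degree m > 0\<close> dvd_imp_degree_le[of m "pderiv m"] by (auto simp: degree_pderiv)
  then have "poly (pderiv (?e m)) \<theta> \<noteq> 0"
    using dvd[of "pderiv m"] by (auto simp: of_rat_hom.map_poly_pderiv)
  moreover have "order \<theta> (?e m) = Suc (order \<theta> (pderiv (?e m)))"
    using m \<open>m \<noteq> 0\<close> by (intro order_pderiv) auto
  ultimately have "order \<theta> (?e m) = 1"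
    by (simp add: order_0I)
  moreover have "order \<theta> (?e q) = 0"
    using q dvd by (blast intro: order_0I)
  moreover have "?e p' = ?e m ^ k * ?e q"
    by (simp add: q(1) of_rat_poly.hom_mult of_rat_poly.hom_power)
  moreover have "?e p' \<noteq> 0"
    using p'(1) by simp
  ultimately have "order \<theta> (?e p') = k"
    using \<open>m \<noteq> 0\<close> by (simp add: order_mult order_power_eq)
  moreover have "r \<le> order \<theta> (?e p')"
    using r \<open>p \<noteq> 0\<close> by (simp add: p'(3) order_divides)
  moreover have "degree p' = k * degree m + degree q"
    using \<open>m \<noteq> 0\<close> \<open>q \<noteq> 0\<close> by (simp add: q(1) degree_mult_eq degree_power_eq)
  ultimately show "algebraic_degree \<theta> * r \<le> degree p"
    unfolding algebraic_degree_def m_def[symmetric] using p'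
    by (metis le_add1 le_trans mult.commute mult_le_mono1)
qed

section \<open>Function spans and a spanning set for the functions \<open>f\<^sub>x\<close>\<close>

text \<open>The coefficients are explicit because they later become matrix entries. \<open>G\<close>
  is meant to be finite: over an infinite set the sum is 0.\<close>

definition fun_span :: "('a \<Rightarrow> real) set \<Rightarrow> ('a \<Rightarrow> real) set" where
  "fun_span G = {f. \<exists>c. \<forall>y. f y = (\<Sum>g\<in>G. c g * g y)}"

lemma fun_span_base:
  assumes "finite G" "g \<in> G"
  shows "g \<in> fun_span G"
proof -
  have "g y = (\<Sum>h\<in>G. (if h = g then 1 else 0) * h y)" for y
    using assms by (subst sum.remove[of _ g]) (auto intro!: sum.neutral)
  then show ?thesis
    unfolding fun_span_def by (intro CollectI exI[of _ "\<lambda>h. if h = g then 1 else 0"]) blast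
qed

lemma fun_span_add:
  assumes "f \<in> fun_span G" "g \<in> fun_span G"
  shows "(\<lambda>y. f y + g y) \<in> fun_span G"
proof -
  obtain c d where "f y = (\<Sum>h\<in>G. c h * h y)" "g y = (\<Sum>h\<in>G. d h * h y)" for y
    using assms unfolding fun_span_def by blast
  then show ?thesis
    unfolding fun_span_def
    by (auto intro!: exI[of _ "\<lambda>h. c h + d h"] simp: algebra_simps sum.distrib)
qed

lemma fun_span_scale:
  assumes "f \<in> fun_span G"
  shows "(\<lambda>y. a * f y) \<in> fun_span G"
proof -
  obtain c where "f y = (\<Sum>h\<in>G. c h * h y)" for y
    using assms unfolding fun_span_def by blast
  then show ?thesis
    unfolding fun_span_def
    by (auto intro!: exI[of _ "\<lambda>h. a * c h"] simp: sum_distrib_left mult.assoc)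
qed

lemma fun_span_sum:
  assumes "\<And>i. i \<in> I \<Longrightarrow> f i \<in> fun_span G"
  shows "(\<lambda>y. \<Sum>i\<in>I. f i y) \<in> fun_span G"
  using assms
proof (induction I rule: infinite_finite_induct)
  case (insert i I)
  then show ?case
    by (simp add: fun_span_add)
qed (auto simp: fun_span_def intro: exI[of _ "\<lambda>_. 0"])

lemma fun_span_mult:
  assumes "f \<in> fun_span G" "\<And>g. g \<in> G \<Longrightarrow> (\<lambda>y. g y * h y) \<in> fun_span G'"
  shows "(\<lambda>y. f y * h y) \<in> fun_span G'"
proof -
  obtain c where f: "f y = (\<Sum>g\<in>G. c g * g y)" for y
    using assms(1) unfolding fun_span_def by blast
  have "(\<lambda>y. \<Sum>g\<in>G. c g * (g y * h y)) \<in> fun_span G'"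
    by (intro fun_span_sum fun_span_scale assms(2))
  then show ?thesis
    by (simp add: f sum_distrib_right mult.assoc)
qed

text \<open>\<open>None\<close> stands for the extra variable (\<open>\<xi>\<^sub>0\<close> or the homogenizing variable 1), \<open>Some k\<close> for the
  \<open>k\<close>-th coordinate.\<close>

definition monom_fun :: "(real ^ 'd \<Rightarrow> real) \<Rightarrow> 'd option multiset \<Rightarrow> real ^ 'd \<Rightarrow> real" where
  "monom_fun h M y = (\<Prod>i\<in>#M. case i of None \<Rightarrow> h y | Some k \<Rightarrow> vec_nth y k)"

abbreviation sqnorm :: "real ^ 'd \<Rightarrow> real" where
  "sqnorm y \<equiv> (norm y)\<^sup>2"

text \<open>Replacing \<open>\<xi>\<^sub>0\<close> by the sum of the squared coordinates raises the total degree by one, so every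
  monomial of degree at most \<open>k\<close> in \<open>\<xi>\<^sub>0\<close> and the coordinates can be rewritten until it has degree
  exactly \<open>k\<close> or no longer contains \<open>\<xi>\<^sub>0\<close>. This is where the two binomial coefficients of \<open>N\<close>
  come from.\<close>

definition sphere_basis :: "nat \<Rightarrow> (real ^ 'd \<Rightarrow> real) set" where
  "sphere_basis k = monom_fun sqnorm ` {M. size M = k} \<union> monom_fun (\<lambda>_. 1) ` {M. Suc (size M) = k}"

lemma monom_fun_add_mset [simp]:
  "monom_fun h (add_mset None M) y = h y * monom_fun h M y"
  "monom_fun h (add_mset (Some k) M) y = vec_nth y k * monom_fun h M y"
  by (simp_all add: monom_fun_def)

lemma monom_fun_cong: "None \<notin># M \<Longrightarrow> monom_fun h M = monom_fun h' M"
  by (auto simp: monom_fun_def fun_eq_iff intro!: arg_cong[of _ _ prod_mset] image_mset_cong split: option.split)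

lemma sqnorm_eq_sum: "sqnorm y = (\<Sum>i\<in>UNIV. vec_nth y i * vec_nth y i)"
  by (simp add: power2_norm_eq_inner inner_vec_def)

lemma finite_size_mset: "finite {M :: 'a :: finite multiset. size M = k}"
  using finite_multisets_of_size[of "UNIV :: 'a set" k] by (simp add: multisets_of_size_def)

lemma card_size_mset: "card {M :: 'a :: finite multiset. size M = k} = (CARD('a) + k - 1) choose k"
  using card_multisets_of_size[of "UNIV :: 'a set" k] by (simp add: multisets_of_size_def)

lemma sphere_basis_Suc:
  "sphere_basis (Suc k) = monom_fun sqnorm ` {M. size M = Suc k} \<union> monom_fun (\<lambda>_. 1) ` {M. size M = k}"
  by (simp add: sphere_basis_def)

lemma finite_sphere_basis [simp]: "finite (sphere_basis k)"
  by (cases k) (auto simp: sphere_basis_def intro!: finite_imageI finite_size_mset)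

text \<open>Stars and bars on the d + 1 symbols of the option type. For k = s - 2 the bound is the
  number \<open>N\<close>.\<close>

lemma card_sphere_basis:
  "card (sphere_basis (Suc k) :: (real ^ 'd \<Rightarrow> real) set) \<le>
    ((CARD('d) + Suc k) choose Suc k) + ((CARD('d) + k) choose k)"
proof -
  let ?M = "\<lambda>k. {M :: 'd option multiset. size M = k}"
  have "card (sphere_basis (Suc k) :: (real ^ 'd \<Rightarrow> real) set)
      \<le> card (monom_fun sqnorm ` ?M (Suc k)) + card (monom_fun (\<lambda>_. 1) ` ?M k)"
    unfolding sphere_basis_Suc by (rule card_Un_le)
  also have "\<dots> \<le> card (?M (Suc k)) + card (?M k)"
    by (intro add_mono card_image_le finite_size_mset)
  finally show ?thesis
    by (simp add: card_size_mset)
qed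

text \<open>1, the coordinates and \<open>sqnorm\<close> are the building blocks of a squared
  distance as a function of \<open>y\<close>; multiplying by any of them costs one degree.\<close>

lemma sphere_basis_mult:
  fixes g :: "real ^ 'd \<Rightarrow> real"
  assumes "g \<in> sphere_basis k"
  shows "g \<in> fun_span (sphere_basis (Suc k))"
    and "(\<lambda>y. g y * vec_nth y i) \<in> fun_span (sphere_basis (Suc k))"
    and "(\<lambda>y. g y * sqnorm y) \<in> fun_span (sphere_basis (Suc k))"
proof -
  let ?B = "sphere_basis (Suc k) :: (real ^ 'd \<Rightarrow> real) set"
  \<comment> \<open>\<open>H\<close> covers monomials of degree exactly k + 1 that may involve
    \<open>sqnorm\<close>; \<open>E\<close> covers coordinate monomials of degree at most k, padded
    by factors 1.\<close>
  have H: "monom_fun sqnorm M \<in> fun_span ?B" if "size M = Suc k" for M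
    using that by (intro fun_span_base finite_sphere_basis) (auto simp: sphere_basis_Suc)
  have E: "monom_fun (\<lambda>_. 1) M \<in> fun_span ?B" if "size M = k" for M
    using that by (intro fun_span_base finite_sphere_basis) (auto simp: sphere_basis_Suc)
  consider (H) M where "size M = k" "g = monom_fun sqnorm M"
    | (E) M where "Suc (size M) = k" "g = monom_fun (\<lambda>_. 1) M"
    using assms unfolding sphere_basis_def by blast
  note cases = this
  show "g \<in> fun_span ?B"
  proof (cases rule: cases)
    case H': H
    \<comment> \<open>Expanding one factor \<open>sqnorm\<close> raises the degree from k to k + 1.
      Without such a factor, \<open>g\<close> is a coordinate monomial of degree k, hence of type
      \<open>E\<close>.\<close>
    show ?thesis
    proof (cases "None \<in># M")
      case True
      then obtain M' where M: "M = add_mset None M'"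
        by (blast dest: multi_member_split)
      have "(\<lambda>y. \<Sum>i\<in>UNIV. monom_fun sqnorm (add_mset (Some i) (add_mset (Some i) M')) y) \<in> fun_span ?B"
        using H' by (intro fun_span_sum H) (simp add: M)
      moreover have "(\<lambda>y. \<Sum>i\<in>UNIV. monom_fun sqnorm (add_mset (Some i) (add_mset (Some i) M')) y) = g"
        by (simp add: H' M fun_eq_iff sqnorm_eq_sum sum_distrib_right mult.assoc)
      ultimately show ?thesis
        by simp
    next
      case False
      then show ?thesis
        using E H' monom_fun_cong by metis
    qed
  next
    case E': E
    have "g = monom_fun (\<lambda>_. 1) (add_mset None M)"
      by (simp add: E' fun_eq_iff)
    then show ?thesis
      using E' E[of "add_mset None M"] by simp
  qed
  show "(\<lambda>y. g y * vec_nth y i) \<in> fun_span ?B"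
  proof (cases rule: cases)
    case H': H
    then show ?thesis
      using H[of "add_mset (Some i) M"] by (simp add: H' mult.commute[of _ "vec_nth _ i"] flip: monom_fun_add_mset)
  next
    case E': E
    then show ?thesis
      using E[of "add_mset (Some i) M"] by (simp add: E' mult.commute[of _ "vec_nth _ i"] flip: monom_fun_add_mset)
  qed
  show "(\<lambda>y. g y * sqnorm y) \<in> fun_span ?B"
  proof (cases rule: cases)
    case H': H
    have "(\<lambda>y. g y * sqnorm y) = monom_fun sqnorm (add_mset None M)"
      by (simp add: H' fun_eq_iff)
    then show ?thesis
      using H' H[of "add_mset None M"] by simp
  next
    case E': E
    \<comment> \<open>Two coordinates join a monomial of size k - 1. If it contains a padding factor
      1, dropping that leaves size k, as \<open>E\<close> requires; otherwise the result has size k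
      + 1 and no padding, as \<open>H\<close> requires.\<close>
    have "monom_fun (\<lambda>_. 1) (add_mset (Some i) (add_mset (Some i) M)) \<in> fun_span ?B" (is "?f \<in> _") for i
    proof (cases "None \<in># M")
      case True
      then obtain M' where M: "M = add_mset None M'"
        by (blast dest: multi_member_split)
      have "?f = monom_fun (\<lambda>_. 1) (add_mset (Some i) (add_mset (Some i) M'))"
        by (simp add: M fun_eq_iff)
      then show ?thesis
        using E[of "add_mset (Some i) (add_mset (Some i) M')"] E' M by simp
    next
      case False
      then have "?f = monom_fun sqnorm (add_mset (Some i) (add_mset (Some i) M))"
        by (intro monom_fun_cong) auto
      then show ?thesis
        using H[of "add_mset (Some i) (add_mset (Some i) M)"] E' by simp
    qed
    then have "(\<lambda>y. \<Sum>i\<in>UNIV. monom_fun (\<lambda>_. 1) (add_mset (Some i) (add_mset (Some i) M)) y) \<in> fun_span ?B"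
      by (intro fun_span_sum)
    moreover have "(\<lambda>y. \<Sum>i\<in>UNIV. monom_fun (\<lambda>_. 1) (add_mset (Some i) (add_mset (Some i) M)) y)
        = (\<lambda>y. g y * sqnorm y)"
      by (simp add: E' fun_eq_iff sqnorm_eq_sum sum_distrib_left mult_ac)
    ultimately show ?thesis
      by simp
  qed
qed

text \<open>Each factor is a linear combination of 1, the coordinates of \<open>y\<close> and
  \<open>sqnorm y\<close>, so every new factor moves the product to the next
  \<open>sphere_basis\<close>.\<close>

lemma prod_sq_dist_in_fun_span:
  fixes x :: "real ^ 'd"
  assumes "finite I"
  shows "(\<lambda>y. \<Prod>i\<in>I. (a i - (norm (x - y))\<^sup>2) / b i) \<in> fun_span (sphere_basis (card I))"
  using assms
proof (induction I rule: finite_induct)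
  case empty
  have "(\<lambda>_. 1) = (monom_fun sqnorm {#} :: real ^ 'd \<Rightarrow> real)"
    by (simp add: monom_fun_def fun_eq_iff)
  then have "(\<lambda>_. 1) \<in> (sphere_basis 0 :: (real ^ 'd \<Rightarrow> real) set)"
    by (auto simp: sphere_basis_def)
  then show ?case
    by (simp add: fun_span_base)
next
  case (insert j I)
  let ?f = "\<lambda>y. \<Prod>i\<in>I. (a i - (norm (x - y))\<^sup>2) / b i"
  let ?S = "fun_span (sphere_basis (Suc (card I))) :: (real ^ 'd \<Rightarrow> real) set"
  have factor: "(a j - (norm (x - y))\<^sup>2) / b j =
      (a j - sqnorm x) / b j + (\<Sum>i\<in>UNIV. 2 * vec_nth x i / b j * vec_nth y i) + (- 1 / b j) * sqnorm y" for y
  proof -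
    have "(norm (x - y))\<^sup>2 = sqnorm x - 2 * (\<Sum>i\<in>UNIV. vec_nth x i * vec_nth y i) + sqnorm y"
      by (simp add: sqnorm_eq_sum algebra_simps sum.distrib sum_subtractf sum_distrib_left)
    moreover have "(\<Sum>i\<in>UNIV. 2 * vec_nth x i / b j * vec_nth y i) = 2 / b j * (\<Sum>i\<in>UNIV. vec_nth x i * vec_nth y i)"
      by (simp add: sum_distrib_left mult.assoc)
    ultimately show ?thesis
      by (simp add: diff_divide_distrib add_divide_distrib)
  qed
  have "(\<lambda>y. ?f y * 1) \<in> ?S"
    by (rule fun_span_mult[OF insert.IH]) (simp add: sphere_basis_mult)
  moreover have "(\<lambda>y. ?f y * vec_nth y i) \<in> ?S" for i
    by (rule fun_span_mult[OF insert.IH]) (simp add: sphere_basis_mult)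
  moreover have "(\<lambda>y. ?f y * sqnorm y) \<in> ?S"
    by (rule fun_span_mult[OF insert.IH]) (simp add: sphere_basis_mult)
  ultimately have "(\<lambda>y. (a j - sqnorm x) / b j * (?f y * 1) +
      (\<Sum>i\<in>UNIV. 2 * vec_nth x i / b j * (?f y * vec_nth y i)) + (- 1 / b j) * (?f y * sqnorm y)) \<in> ?S"
    by (intro fun_span_add fun_span_sum fun_span_scale)
  also have "(\<lambda>y. (a j - sqnorm x) / b j * (?f y * 1) +
      (\<Sum>i\<in>UNIV. 2 * vec_nth x i / b j * (?f y * vec_nth y i)) + (- 1 / b j) * (?f y * sqnorm y)) =
      (\<lambda>y. (a j - (norm (x - y))\<^sup>2) / b j * ?f y)"
    unfolding factor by (simp only: distrib_left distrib_right sum_distrib_left sum_distrib_right mult_ac mult_1)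
  finally show ?case
    using insert.hyps by simp
qed

section \<open>The characteristic polynomial of the integer matrix\<close>

lemma sum_const_poly: "(\<Sum>i\<in>I. [:f i:]) = [:\<Sum>i\<in>I. f i:]"
  by (induction I rule: infinite_finite_induct) auto

lemma algebraic_degree_diagonal_le:
  fixes f :: "'a \<Rightarrow> 'a \<Rightarrow> real"
  assumes X: "finite X" and G: "finite G" "card G < card X"
    and span: "\<And>x. x \<in> X \<Longrightarrow> f x \<in> fun_span G"
    and diag: "\<And>x. x \<in> X \<Longrightarrow> f x x = \<kappa>"
    and off_diag: "\<And>x y. x \<in> X \<Longrightarrow> y \<in> X \<Longrightarrow> x \<noteq> y \<Longrightarrow> f x y \<in> \<int>"
  shows "algebraic_int (complex_of_real \<kappa>)"
    and "algebraic_degree (complex_of_real \<kappa>) * (card X - card G) \<le> card X"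
proof -
  \<comment> \<open>The matrix \<open>f\<close> equals \<open>\<kappa> 1 - A\<close> with \<open>A\<close> integral, and it factors as \<open>- B C\<close> through the
    span of \<open>G\<close>; hence the characteristic matrix of \<open>A\<close> is \<open>(x - \<kappa>) 1 - B C\<close>.\<close>
  define n m where "n = card X" and "m = card G"
  obtain e where e: "bij_betw e {0..<n} X"
    using ex_bij_betw_nat_finite[OF X] unfolding n_def by blast
  obtain g where g: "bij_betw g {0..<m} G"
    using ex_bij_betw_nat_finite[OF G(1)] unfolding m_def by blast
  obtain c where c: "f x y = (\<Sum>h\<in>G. c x h * h y)" if "x \<in> X" for x y
    using span unfolding fun_span_def by (auto simp: Bex_def) metis
  have eX: "e i \<in> X" if "i < n" for i
    using e that by (auto simp: bij_betw_def)
  have e_eq: "e i = e j \<longleftrightarrow> i = j" if "i < n" "j < n" for i j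
    using e that by (auto simp: bij_betw_def inj_on_def)
  have f_eq: "f (e i) (e j) = (\<Sum>k = 0..<m. c (e i) (g k) * g k (e j))" if "i < n" for i j
    using c[OF eX[OF that]] sum.reindex_bij_betw[OF g, of "\<lambda>h. c (e i) h * h (e j)"] by simp
  \<comment> \<open>The floor only changes the type: the off-diagonal values are integers
    already.\<close>
  define A :: "int mat" where
    "A = Matrix.mat n n (\<lambda>(i, j). if i = j then 0 else - \<lfloor>f (e i) (e j)\<rfloor>)"
  define u :: "complex poly" where "u = [:- complex_of_real \<kappa>, 1:]"
  define B :: "complex poly mat" where "B = Matrix.mat n m (\<lambda>(i, k). [:- complex_of_real (c (e i) (g k)):])"
  define C :: "complex poly mat" where "C = Matrix.mat m n (\<lambda>(k, j). [:complex_of_real (g k (e j)):])"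
  have A: "A \<in> carrier_mat n n" and B: "B \<in> carrier_mat n m" and C: "C \<in> carrier_mat m n"
    by (auto simp: A_def B_def C_def)
  have BC: "(B * C) $$ (i, j) = [:- complex_of_real (f (e i) (e j)):]" if "i < n" "j < n" for i j
    using that by (simp add: B_def C_def scalar_prod_def f_eq sum_const_poly sum_negf mult.commute)
  have "char_poly_matrix (map_mat of_int A) = u \<cdot>\<^sub>m 1\<^sub>m n - B * C"
  proof (rule eq_matI)
    fix i j
    assume "i < dim_row (u \<cdot>\<^sub>m 1\<^sub>m n - B * C)" "j < dim_col (u \<cdot>\<^sub>m 1\<^sub>m n - B * C)"
    then have ij: "i < n" "j < n"
      using B C by auto
    have "of_int \<lfloor>f (e i) (e j)\<rfloor> = complex_of_real (f (e i) (e j))" if "i \<noteq> j"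
      using off_diag[OF eX eX, of i j] ij that e_eq by (auto elim!: Ints_cases)
    moreover have "(u \<cdot>\<^sub>m 1\<^sub>m n - B * C) $$ (i, j) = (if i = j then u else 0) - (B * C) $$ (i, j)"
      using ij B C by simp
    ultimately show "char_poly_matrix (map_mat of_int A) $$ (i, j) = (u \<cdot>\<^sub>m 1\<^sub>m n - B * C) $$ (i, j)"
      using ij diag[OF eX] by (simp add: BC char_poly_matrix_def A_def u_def)
  qed (use A B C in \<open>auto simp: char_poly_matrix_def\<close>)
  then have "map_poly of_int (char_poly A) = Determinant.det (u \<cdot>\<^sub>m 1\<^sub>m n - B * C)"
    unfolding of_int_hom.char_poly_hom[OF A, symmetric] by (simp only: char_poly_def)
  \<comment> \<open>Thus \<open>\<kappa>\<close> is a root of the characteristic polynomial of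
    multiplicity at least n - m.\<close>
  then have dvd: "u ^ (n - m) dvd map_poly of_int (char_poly A)"
    using smult_one_mat_minus_mult_det_dvd[OF B C, of u] G by (simp add: u_def n_def m_def)
  have "degree (char_poly A) = n" "lead_coeff (char_poly A) = 1"
    using degree_monic_char_poly[OF A] by auto
  then show "algebraic_int (complex_of_real \<kappa>)"
    and "algebraic_degree (complex_of_real \<kappa>) * (card X - card G) \<le> card X"
    using algebraic_degree_mult_order_le[OF _ dvd[unfolded u_def]] G by (auto simp: n_def m_def)
qed

section \<open>Application to distance sets\<close>

theorem theorem4p1:
  fixes X :: "(real ^ 'd) set" and d s t N :: nat and \<alpha> K :: "nat \<Rightarrow> real"
  assumes "d = CARD('d)"
    and "s \<ge> 2"
    and "distance_set s X"
    and "bij_betw \<alpha> {1..s} (sq_dists X)"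
    and "N = ((d + s - 1) choose (s - 1)) + ((d + s - 2) choose (s - 2))"
    and "t \<ge> 1"
    and "real (card X) \<ge> real N + (real N + 1) / real t"
    and "\<And>j. j \<in> {1..s} \<Longrightarrow> K j = (\<Prod>i\<in>{1..s} - {j}. \<alpha> i / (\<alpha> i - \<alpha> j))"
  shows "\<forall>j\<in>{1..s}. algebraic_int (complex_of_real (K j)) \<and>
    algebraic_degree (complex_of_real (K j)) \<le> t"
proof
  fix j
  assume j: "j \<in> {1..s}"
  let ?I = "{1..s} - {j}"
  define f :: "real ^ 'd \<Rightarrow> real ^ 'd \<Rightarrow> real"
    where "f x y = (\<Prod>i\<in>?I. (\<alpha> i - (norm (x - y))\<^sup>2) / (\<alpha> i - \<alpha> j))" for x y
  define G :: "(real ^ 'd \<Rightarrow> real) set" where "G = sphere_basis (s - 1)"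
  obtain k where s: "s = Suc (Suc k)"
    using \<open>s \<ge> 2\<close> by (metis add_2_eq_Suc le_Suc_ex)
  have inj: "\<alpha> i = \<alpha> i' \<longleftrightarrow> i = i'" if "i \<in> {1..s}" "i' \<in> {1..s}" for i i'
    using assms(4) that by (meson bij_betw_imp_inj_on inj_on_eq_iff)
  have X: "finite X"
    using assms(3) by (simp add: distance_set_def)
  have G: "finite G" "card G \<le> N"
    using card_sphere_basis[where 'd = 'd, of k] by (simp_all add: G_def s assms(1,5))
  have "real t * real N + real N + 1 \<le> real t * real (card X)"
    using assms(6,7) by (simp add: field_simps)
  then have "real (t * N + N + 1) \<le> real (t * card X)"
    by simp
  then have t_card: "t * N + N + 1 \<le> t * card X"
    by (simp only: of_nat_le_iff)
  \<comment> \<open>If \<open>card X\<close> were at most \<open>N\<close>, then t *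
    \<open>card X\<close> would be at most t * \<open>N\<close>, against
    \<open>t_card\<close>.\<close>
  then have less: "N < card X"
    using mult_le_mono2[of "card X" N t] by linarith
  then have card: "card G < card X"
    using G(2) by simp
  have span: "f x \<in> fun_span G" for x
    using prod_sq_dist_in_fun_span[of ?I \<alpha> x "\<lambda>i. \<alpha> i - \<alpha> j"] j by (simp add: G_def f_def[abs_def])
  have diag: "f x x = K j" for x
    using assms(8)[OF j] by (simp add: f_def)
  have off_diag: "f x y \<in> \<int>" if xy: "x \<in> X" "y \<in> X" "x \<noteq> y" for x y
  proof -
    have "(norm (x - y))\<^sup>2 \<in> sq_dists X"
      using xy unfolding sq_dists_def by blast
    then obtain i where i: "i \<in> {1..s}" "(norm (x - y))\<^sup>2 = \<alpha> i"
      using bij_betw_imp_surj_on[OF assms(4)] by blast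
    show ?thesis
    \<comment> \<open>At squared distance \<open>\<alpha> j\<close> all factors are 1; at any other
      \<open>\<alpha> i\<close> the factor with index \<open>i\<close> vanishes.\<close>
    proof (cases "i = j")
      case True
      then have "f x y = 1"
        unfolding f_def i(2) using inj j by (intro prod.neutral) auto
      then show ?thesis
        by simp
    next
      case False
      then have "f x y = 0"
        unfolding f_def i(2) using i(1) by (intro prod_zero) auto
      then show ?thesis
        by simp
    qed
  qed
  let ?deg = "algebraic_degree (complex_of_real (K j))"
  note * = algebraic_degree_diagonal_le[of X G f "K j", OF X G(1) card span diag off_diag]
  \<comment> \<open>A degree of at least t + 1 would give (t + 1)(|X| - N) \<le> |X|, that is t|X|
    \<le> (t + 1)N, which the summand 1 in \<open>t_card\<close> excludes.\<close>
  have "?deg \<le> t"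
  proof (rule ccontr)
    assume "\<not> ?deg \<le> t"
    then have "(t + 1) * (card X - N) \<le> ?deg * (card X - card G)"
      using G(2) by (intro mult_le_mono) auto
    also have "\<dots> \<le> card X"
      by (rule *(2))
    finally have "(t + 1) * (card X - N) \<le> card X" .
    moreover have "(t + 1) * (card X - N) + (t + 1) * N = (t + 1) * card X"
      using less by (simp flip: add_mult_distrib2)
    ultimately show False
      using t_card by (simp add: algebra_simps)
  qed
  then show "algebraic_int (complex_of_real (K j)) \<and> ?deg \<le> t"
    using *(1) by simp
qed

end
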